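(* Let $\mathcal W\subset\mathbb R^d$ be a nonempty compact convex set, $B:=\sup_{w\in\mathcal W}\|w\|_\infty$ and $\mathcal D=\{x\in\mathbb R^d:\|x\|_\infty\le B\}$. Let $G>0$ and let the losses $f_t$ be differentiable, $H$-strongly convex in $L_2$ norm on $\mathcal D$, with $\|\nabla f_t(x)\|_\infty\le G$ for all $x\in\mathcal D$. Let $\mathcal A$ be the algorithm of the coordinate-wise FLH-OGD construction (Corollary 1) on $\mathcal D$ with $G_\infty=2G$. Consider the scheme: at round $t$ obtain $x_t\in\mathcal D$ from $\mathcal A$, play $\hat x_t=\Pi_{\mathcal W}(x_t)\in\arg\min_{y\in\mathcal W}\|x_t-y\|_1$, observe $f_t$, and feed $\mathcal A$ the surrogate loss $\ell_t(x)=f_t(x)+G\,S(x)$ with $S(x)=\|x-\Pi_{\mathcal W}(x)\|_1$ (using its subgradients). Then for every $C_n\ge 0$ and every comparator sequence $w_1,\dots,w_n\in\mathcal W$ with $\sum_{t=2}^n\|w_t-w_{t-1}\|_1\le C_n$, $$\sum_{t=1}^n f_t(\hat x_t)-f_t(w_t)=\tilde O\big(d^{1/3}n^{1/3}C_n^{2/3}\vee d\big),$$ where $\tilde O$ hides constants and factors depending on $\log n$, $H$, $G$, $B$.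
   Context: Coordinate-wise FLH-OGD (Corollary 1) for $H$-strongly convex losses $g_t$ on $\mathcal D$ with $\|\nabla g_t\|_\infty\le G_\infty$ (gradients may be subgradients): run $d$ independent instances of univariate FLH-OGD with decision set $[-B,B]$ and learning rate $\zeta=1/(2(2B+G_\infty/H)^2)$; instance $i$ outputs $x_t[i]$ and receives the squared loss $x\mapsto\big(x-(x_t[i]-\nabla g_t(x_t)[i]/H)\big)^2$. Univariate FLH-OGD on squared losses $x\mapsto(y_t-x)^2$: for each $j$ a base learner started at time $j$ runs projected OGD on $[-B,B]$ from a fixed start point with $x^{(j)}_{t+1}=\Pi(x^{(j)}_t-\frac{1}{2\tau}2(x^{(j)}_t-y_t))$, $\tau=t-j+1$; the FLH meta-algorithm keeps weights $v_t$, $v_1=(1)$, predicts $x_t=\sum_{j\le t}v^{(j)}_tx^{(j)}_t$, updates $\hat v^{(i)}_{t+1}\propto v^{(i)}_te^{-\zeta(y_t-x^{(i)}_t)^2}$ ($i\le t$, normalized), $v^{(t+1)}_{t+1}=1/(t+1)$, $v^{(i)}_{t+1}=(1-\frac1{t+1})\hat v^{(i)}_{t+1}$. $a\vee b=\max\{a,b\}$. *)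

theory Defs
  imports "HOL-Analysis.Analysis"
begin

definition vecs :: "nat \<Rightarrow> (nat \<Rightarrow> real) set" where
  "vecs d = {x. \<forall>i\<ge>d. x i = 0}"

definition inner_d :: "nat \<Rightarrow> (nat \<Rightarrow> real) \<Rightarrow> (nat \<Rightarrow> real) \<Rightarrow> real" where
  "inner_d d x y = (\<Sum>i<d. x i * y i)"

definition norm1_d :: "nat \<Rightarrow> (nat \<Rightarrow> real) \<Rightarrow> real" where
  "norm1_d d x = (\<Sum>i<d. \<bar>x i\<bar>)"

definition norm2_d :: "nat \<Rightarrow> (nat \<Rightarrow> real) \<Rightarrow> real" where
  "norm2_d d x = sqrt (\<Sum>i<d. (x i)\<^sup>2)"

definition norminf_d :: "nat \<Rightarrow> (nat \<Rightarrow> real) \<Rightarrow> real" where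
  "norminf_d d x = Max (insert 0 ((\<lambda>i. \<bar>x i\<bar>) ` {..<d}))"

definition convex_d :: "(nat \<Rightarrow> real) set \<Rightarrow> bool" where
  "convex_d W = (\<forall>x\<in>W. \<forall>y\<in>W. \<forall>u::real. 0 \<le> u \<and> u \<le> 1 \<longrightarrow>
                   (\<lambda>i. (1 - u) * x i + u * y i) \<in> W)"

definition box_d :: "nat \<Rightarrow> real \<Rightarrow> (nat \<Rightarrow> real) set" where
  "box_d d B = {x \<in> vecs d. norminf_d d x \<le> B}"

definition has_grad_within :: "nat \<Rightarrow> ((nat \<Rightarrow> real) \<Rightarrow> real) \<Rightarrow> (nat \<Rightarrow> real)
      \<Rightarrow> (nat \<Rightarrow> real) \<Rightarrow> (nat \<Rightarrow> real) set \<Rightarrow> bool" where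
  "has_grad_within d f g x D =
     (g \<in> vecs d \<and> (\<forall>e>0. \<exists>\<delta>>0. \<forall>y\<in>D. norm2_d d (\<lambda>i. y i - x i) < \<delta> \<longrightarrow>
        \<bar>f y - f x - inner_d d g (\<lambda>i. y i - x i)\<bar> \<le> e * norm2_d d (\<lambda>i. y i - x i)))"

definition strongly_convex_on_d :: "nat \<Rightarrow> real \<Rightarrow> (nat \<Rightarrow> real) set
      \<Rightarrow> ((nat \<Rightarrow> real) \<Rightarrow> real) \<Rightarrow> ((nat \<Rightarrow> real) \<Rightarrow> (nat \<Rightarrow> real)) \<Rightarrow> bool" where
  "strongly_convex_on_d d H D f Df =
     (\<forall>x\<in>D. \<forall>y\<in>D. f y \<ge> f x + inner_d d (Df x) (\<lambda>i. y i - x i)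
                         + H / 2 * (norm2_d d (\<lambda>i. y i - x i))\<^sup>2)"

text \<open>S(x) = || x - Pi_W(x) ||_1, the L1 distance from x to W.\<close>
definition dist1_set :: "nat \<Rightarrow> (nat \<Rightarrow> real) set \<Rightarrow> (nat \<Rightarrow> real) \<Rightarrow> real" where
  "dist1_set d W x = (INF y\<in>W. norm1_d d (\<lambda>i. x i - y i))"

section \<open>Univariate FLH-OGD on squared losses (y_t - x)^2 over [-B,B]\<close>

definition clamp :: "real \<Rightarrow> real \<Rightarrow> real" where
  "clamp B x = max (- B) (min B x)"

text \<open>Base learner started at time j (times start at 1), start point s, target
  sequence y. ogd_base s B y j k is its prediction at time j + k.
  Update: x_{t+1} = Pi(x_t - 1/(2 tau) * 2 (x_t - y_t)), tau = t - j + 1 = k + 1.\<close>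
fun ogd_base :: "real \<Rightarrow> real \<Rightarrow> (nat \<Rightarrow> real) \<Rightarrow> nat \<Rightarrow> nat \<Rightarrow> real" where
  "ogd_base s B y j 0 = s"
| "ogd_base s B y j (Suc k) =
     (let b = ogd_base s B y j k in
      clamp B (b - 1 / (2 * real (Suc k)) * (2 * (b - y (j + k)))))"

text \<open>FLH weights v_t (index t = time, t >= 1; entries i in {1..t}).\<close>
fun flh_weights :: "real \<Rightarrow> real \<Rightarrow> real \<Rightarrow> (nat \<Rightarrow> real) \<Rightarrow> nat \<Rightarrow> nat \<Rightarrow> real" where
  "flh_weights s B \<zeta> y 0 = (\<lambda>i. 0)"
| "flh_weights s B \<zeta> y (Suc t) =
     (if t = 0 then (\<lambda>i. if i = 1 then 1 else 0)
      else (let v = flh_weights s B \<zeta> y t;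
                L = (\<lambda>k. v k * exp (- \<zeta> * (y t - ogd_base s B y k (t - k))\<^sup>2));
                Z = (\<Sum>k\<in>{1..t}. L k)
            in (\<lambda>i. if i = Suc t then 1 / real (Suc t)
                     else if 1 \<le> i \<and> i \<le> t then (1 - 1 / real (Suc t)) * (L i / Z)
                     else 0)))"

definition flh_pred :: "real \<Rightarrow> real \<Rightarrow> real \<Rightarrow> (nat \<Rightarrow> real) \<Rightarrow> nat \<Rightarrow> real" where
  "flh_pred s B \<zeta> y t = (\<Sum>j\<in>{1..t}. flh_weights s B \<zeta> y t j * ogd_base s B y j (t - j))"

end

theory Submission
  imports Defs
begin

text \<open>The surrogate loss and strong convexity bound the regret of a round by \<open>H / 2\<close> times the sum
  over coordinates of the regrets for the squared losses with targets \<open>x - g / H\<close>, where \<open>g\<close> is a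
  subgradient of the surrogate. So it suffices to bound the dynamic regret of one univariate FLH-OGD
  instance, whose regret against any constant in \<open>[-B, B]\<close> on any interval is at most some \<open>L\<close> of
  order \<open>log n\<close>.

  Fix \<open>\<epsilon> < B\<close>. It suffices to compare with the minimiser \<open>w\<close> of the squared error plus \<open>L / \<epsilon>\<close> times
  the total variation, with credit for its own penalty. Cut time greedily: a bin starting at \<open>a\<close>
  ends just before \<open>w\<close> leaves \<open>[w a - \<epsilon>, w a + \<epsilon>]\<close>. Replacing \<open>w\<close> on a bin by a constant \<open>u\<close> (\<open>w a\<close>,
  or the end of the box that the bin touches) costs a quadratic term of at most \<open>4 \<epsilon>\<^sup>2\<close> per round
  and a linear term; optimality of \<open>w\<close> under dilation of the bin away from \<open>u\<close> bounds the latter by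
  the penalty of the bin, exit jump included, minus \<open>(L / \<epsilon>) \<epsilon> = L\<close>. This saving pays for the
  interval regret \<open>L\<close> of the bin, so that bins need not be counted: the dynamic regret against a
  comparator of total variation \<open>C\<close> is at most \<open>L C / \<epsilon> + 4 n \<epsilon>\<^sup>2 + 2 L\<close>. Taking \<open>\<epsilon>\<close> of order \<open>(C / n)\<close>
  to the power \<open>1/3\<close>, but at least of order \<open>1 / sqrt n\<close>, gives the rate, and concavity of the power
  \<open>2/3\<close> sums it over the coordinates.\<close>

section \<open>Interval regret of univariate FLH-OGD\<close>

definition sq_regret :: "('a \<Rightarrow> real) \<Rightarrow> ('a \<Rightarrow> real) \<Rightarrow> ('a \<Rightarrow> real) \<Rightarrow> 'a set \<Rightarrow> real" where
  "sq_regret y x u I = (\<Sum>t\<in>I. (y t - x t)\<^sup>2 - (y t - u t)\<^sup>2)"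

lemma sq_regret_trans: "sq_regret y x w I = sq_regret y x u I + sq_regret y u w I"
  by (simp add: sq_regret_def flip: sum.distrib)

lemma sq_regret_split:
  assumes "a \<le> Suc b" "b \<le> n"
  shows "sq_regret y x u {a..n} = sq_regret y x u {a..b} + sq_regret y x u {Suc b..n}"
  unfolding sq_regret_def using sum.ub_add_nat[of a b _ "n - b"] assms by simp

lemma abs_clamp_le: "B \<ge> 0 \<Longrightarrow> \<bar>clamp B z\<bar> \<le> B"
  by (auto simp: clamp_def)

lemma clamp_nonexpansive: "\<bar>u\<bar> \<le> B \<Longrightarrow> (clamp B z - u)\<^sup>2 \<le> (z - u)\<^sup>2"
  by (auto simp: clamp_def abs_le_square_iff[symmetric])

lemma abs_ogd_base_le:
  assumes "\<bar>s\<bar> \<le> B"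
  shows "\<bar>ogd_base s B y j k\<bar> \<le> B"
  using assms abs_clamp_le by (cases k) (auto simp: Let_def)

lemma ogd_base_step:
  fixes s B u :: real and y :: "nat \<Rightarrow> real" and a :: nat
  assumes "\<bar>u\<bar> \<le> B"
  defines "b \<equiv> ogd_base s B y a"
  shows "((y (a + k) - b k)\<^sup>2 - (y (a + k) - u)\<^sup>2) + real (Suc k) * (b (Suc k) - u)\<^sup>2
           \<le> real k * (b k - u)\<^sup>2 + (y (a + k) - b k)\<^sup>2 / real (Suc k)"
proof -
  define \<tau> where "\<tau> = real (Suc k)"
  define g where "g = b k - y (a + k)"
  have \<tau>_props: "\<tau> > 0" "real k = \<tau> - 1" by (auto simp: \<tau>_def)
  have "b (Suc k) = clamp B (b k - 1 / (2 * \<tau>) * (2 * g))"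
    by (simp only: b_def g_def \<tau>_def ogd_base.simps Let_def)
  also have "1 / (2 * \<tau>) * (2 * g) = g / \<tau>" using \<tau>_props by simp
  finally have "(b (Suc k) - u)\<^sup>2 \<le> (b k - g / \<tau> - u)\<^sup>2"
    using clamp_nonexpansive[OF assms(1)] by simp
  then have "\<tau> * (b (Suc k) - u)\<^sup>2 \<le> \<tau> * (b k - g / \<tau> - u)\<^sup>2"
    using \<tau>_props by simp
  also have "\<dots> = \<tau> * (b k - u)\<^sup>2 - 2 * g * (b k - u) + g\<^sup>2 / \<tau>"
    using \<tau>_props by (simp add: field_simps power2_eq_square)
  finally show ?thesis
    unfolding \<tau>_def[symmetric] \<tau>_props(2) by (simp add: g_def algebra_simps power2_eq_square)
qed

lemma ogd_base_regret_potential: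
  fixes u :: real
  assumes "\<bar>s\<bar> \<le> B" "\<bar>u\<bar> \<le> B" and "\<And>t. t \<in> {a..<a + m} \<Longrightarrow> B + \<bar>y t\<bar> \<le> A"
  shows "sq_regret y (\<lambda>t. ogd_base s B y a (t - a)) (\<lambda>_. u) {a..<a + m}
           + real m * (ogd_base s B y a m - u)\<^sup>2 \<le> A\<^sup>2 * harm m"
  using assms(3)
proof (induction m)
  case 0
  then show ?case by (simp add: sq_regret_def harm_def)
next
  case (Suc m)
  let ?b = "ogd_base s B y a"
  have "\<bar>y (a + m) - ?b m\<bar> \<le> A"
    using Suc.prems[of "a + m"] abs_ogd_base_le[OF assms(1), of y a m] by auto
  then have "(y (a + m) - ?b m)\<^sup>2 \<le> A\<^sup>2"
    using abs_le_square_iff[of "y (a + m) - ?b m" A] by simp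
  then have "(y (a + m) - ?b m)\<^sup>2 / real (Suc m) \<le> A\<^sup>2 / real (Suc m)"
    by (intro divide_right_mono) auto
  moreover have "sq_regret y (\<lambda>t. ?b (t - a)) (\<lambda>_. u) {a..<a + m} + real m * (?b m - u)\<^sup>2
      \<le> A\<^sup>2 * harm m"
    using Suc by simp
  moreover have "sq_regret y (\<lambda>t. ?b (t - a)) (\<lambda>_. u) {a..<a + Suc m}
      = sq_regret y (\<lambda>t. ?b (t - a)) (\<lambda>_. u) {a..<a + m}
        + ((y (a + m) - ?b m)\<^sup>2 - (y (a + m) - u)\<^sup>2)"
    by (simp add: sq_regret_def)
  moreover have "A\<^sup>2 * harm (Suc m) = A\<^sup>2 * harm m + A\<^sup>2 / real (Suc m)"
    by (simp add: harm_Suc field_simps)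
  ultimately show ?case
    using ogd_base_step[OF assms(2), of y a m s] by linarith
qed

lemma ogd_base_regret:
  fixes u :: real
  assumes "\<bar>s\<bar> \<le> B" "\<bar>u\<bar> \<le> B" "a \<le> b" and "\<And>t. t \<in> {a..b} \<Longrightarrow> B + \<bar>y t\<bar> \<le> A"
  shows "sq_regret y (\<lambda>t. ogd_base s B y a (t - a)) (\<lambda>_. u) {a..b}
           \<le> A\<^sup>2 * (1 + ln (real (Suc b - a)))"
proof -
  define m where "m = Suc b - a"
  have m_pos: "m > 0" and interval_eq: "{a..b} = {a..<a + m}" using assms(3) by (auto simp: m_def)
  have "sq_regret y (\<lambda>t. ogd_base s B y a (t - a)) (\<lambda>_. u) {a..b}
           + real m * (ogd_base s B y a m - u)\<^sup>2 \<le> A\<^sup>2 * harm m"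
    unfolding interval_eq by (rule ogd_base_regret_potential) (use assms interval_eq in auto)
  moreover have "real m * (ogd_base s B y a m - u)\<^sup>2 \<ge> 0" by simp
  ultimately have "sq_regret y (\<lambda>t. ogd_base s B y a (t - a)) (\<lambda>_. u) {a..b} \<le> A\<^sup>2 * harm m"
    by linarith
  also have "harm m \<le> 1 + ln (real m)"
    using euler_mascheroni_sequence_decreasing[of 1 m] m_pos by (simp add: harm_def)
  finally show ?thesis by (simp add: m_def mult_left_mono)
qed

lemma concave_on_exp_neg_square:
  fixes A \<zeta> :: real
  assumes "\<zeta> \<ge> 0" "2 * \<zeta> * A\<^sup>2 \<le> 1"
  shows "concave_on {-A..A} (\<lambda>z. exp (- \<zeta> * z\<^sup>2))"
proof (rule f''_le0_imp_concave)
  fix z assume "z \<in> {-A..A}"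
  then have "z\<^sup>2 \<le> A\<^sup>2" by (intro abs_le_square_iff[THEN iffD1]) auto
  then have "2 * \<zeta> * z\<^sup>2 \<le> 1"
    using assms by (meson mult_left_mono mult_nonneg_nonneg order.trans zero_le_numeral)
  then show "- 2 * \<zeta> * (1 - 2 * \<zeta> * z\<^sup>2) * exp (- \<zeta> * z\<^sup>2) \<le> 0"
    using assms(1) by (simp add: mult_nonneg_nonneg)
  show "((\<lambda>z. exp (- \<zeta> * z\<^sup>2)) has_real_derivative - 2 * \<zeta> * z * exp (- \<zeta> * z\<^sup>2)) (at z)"
    by (auto intro!: derivative_eq_intros)
  show "((\<lambda>z. - 2 * \<zeta> * z * exp (- \<zeta> * z\<^sup>2)) has_real_derivative
      - 2 * \<zeta> * (1 - 2 * \<zeta> * z\<^sup>2) * exp (- \<zeta> * z\<^sup>2)) (at z)"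
    by (auto intro!: derivative_eq_intros simp: algebra_simps power2_eq_square)
qed simp

locale flh_ogd =
  fixes s B \<zeta> :: real and y :: "nat \<Rightarrow> real"
  assumes start_bound: "\<bar>s\<bar> \<le> B"
begin

abbreviation expert :: "nat \<Rightarrow> nat \<Rightarrow> real" where
  "expert j t \<equiv> ogd_base s B y j (t - j)"

abbreviation weight :: "nat \<Rightarrow> nat \<Rightarrow> real" where
  "weight \<equiv> flh_weights s B \<zeta> y"

abbreviation forecast :: "nat \<Rightarrow> real" where
  "forecast \<equiv> flh_pred s B \<zeta> y"

definition mixture :: "nat \<Rightarrow> real" where
  "mixture t = (\<Sum>j\<in>{1..t}. weight t j * exp (- \<zeta> * (y t - expert j t)\<^sup>2))"

lemma weight_Suc:
  assumes "i \<in> {1..t}"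
  shows "weight (Suc t) i
    = real t / real (Suc t) * (weight t i * exp (- \<zeta> * (y t - expert i t)\<^sup>2) / mixture t)"
proof -
  have "1 - 1 / real (Suc t) = real t / real (Suc t)" by (simp add: field_simps)
  then show ?thesis using assms by (auto simp: mixture_def Let_def)
qed

lemma weight_self: "t \<ge> 1 \<Longrightarrow> weight t t = 1 / real t"
  by (cases t) (auto simp: Let_def)

lemma weight_pos: "i \<in> {1..t} \<Longrightarrow> weight t i > 0"
proof (induction t arbitrary: i)
  case (Suc t)
  show ?case
  proof (cases "i = Suc t")
    case True
    then show ?thesis using weight_self[of "Suc t"] by simp
  next
    case False
    then have old: "i \<in> {1..t}" using Suc.prems by auto
    then have "mixture t > 0" unfolding mixture_def using Suc.IH by (intro sum_pos) auto
    then show ?thesis unfolding weight_Suc[OF old] using Suc.IH[OF old] old by simp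
  qed
qed simp

lemma mixture_pos: "t \<ge> 1 \<Longrightarrow> mixture t > 0"
  unfolding mixture_def using weight_pos by (intro sum_pos) auto

lemma sum_weight:
  assumes "t \<ge> 1"
  shows "(\<Sum>i\<in>{1..t}. weight t i) = 1"
proof (cases "t = 1")
  case False
  then obtain k where t_eq: "t = Suc k" "k \<ge> 1" using assms by (cases t) auto
  have "(\<Sum>i\<in>{1..k}. weight t i) = real k / real t * (mixture k / mixture k)"
    unfolding t_eq(1) mixture_def[of k] sum_divide_distrib sum_distrib_left
    by (intro sum.cong refl) (simp only: weight_Suc mixture_def[of k])
  then have "(\<Sum>i\<in>{1..t}. weight t i) = real k / real t + 1 / real t"
    using mixture_pos[OF t_eq(2)] weight_self[OF assms] t_eq by (simp del: flh_weights.simps)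
  also have "\<dots> = 1" using t_eq by (simp add: field_simps)
  finally show ?thesis .
qed simp

lemma weight_le_one:
  assumes "i \<in> {1..t}"
  shows "weight t i \<le> 1"
proof -
  have "weight t i \<le> (\<Sum>i\<in>{1..t}. weight t i)"
    using weight_pos by (intro member_le_sum assms) (auto intro: less_imp_le)
  also have "\<dots> = 1" using assms by (intro sum_weight) auto
  finally show ?thesis .
qed

lemma abs_forecast_le:
  assumes "t \<ge> 1"
  shows "\<bar>forecast t\<bar> \<le> B"
proof -
  have "(\<Sum>j\<in>{1..t}. weight t j *\<^sub>R expert j t) \<in> {-B..B}"
    using sum_weight[OF assms] weight_pos abs_ogd_base_le[OF start_bound]
    by (intro convex_sum) (auto simp: abs_le_iff minus_le_iff intro: less_imp_le)
  then show ?thesis by (auto simp: flh_pred_def)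
qed

lemma mixture_le_exp_forecast_loss:
  assumes "t \<ge> 1" "B + \<bar>y t\<bar> \<le> A" and exp_concave: "\<zeta> \<ge> 0" "2 * \<zeta> * A\<^sup>2 \<le> 1"
  shows "mixture t \<le> exp (- \<zeta> * (y t - forecast t)\<^sup>2)"
proof -
  have "(\<Sum>j\<in>{1..t}. weight t j * exp (- \<zeta> * (y t - expert j t)\<^sup>2))
      \<le> exp (- \<zeta> * (\<Sum>j\<in>{1..t}. weight t j *\<^sub>R (y t - expert j t))\<^sup>2)"
  proof (rule concave_on_sum[OF _ _ concave_on_exp_neg_square[OF exp_concave]])
    show "y t - expert j t \<in> {-A..A}" for j
      using abs_ogd_base_le[OF start_bound, of y j "t - j"] assms(2) by auto
  qed (use assms(1) sum_weight weight_pos in \<open>auto intro: less_imp_le\<close>)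
  also have "(\<Sum>j\<in>{1..t}. weight t j *\<^sub>R (y t - expert j t)) = y t - forecast t"
    using sum_weight[OF assms(1)]
    by (simp add: flh_pred_def right_diff_distrib sum_subtractf flip: sum_distrib_right)
  finally show ?thesis unfolding mixture_def .
qed

lemma ln_weight_Suc:
  assumes "i \<in> {1..t}"
  shows "ln (weight (Suc t) i) + ln (real (Suc t))
    = ln (weight t i) + ln (real t) - \<zeta> * (y t - expert i t)\<^sup>2 - ln (mixture t)"
  using weight_pos[OF assms] mixture_pos[of t] assms
  by (simp add: weight_Suc[OF assms] ln_mult ln_div del: flh_weights.simps)

lemma regret_against_expert:
  assumes "1 \<le> a" and exp_concave: "\<zeta> \<ge> 0" "2 * \<zeta> * A\<^sup>2 \<le> 1"
    and "\<And>t. t \<in> {a..<a + m} \<Longrightarrow> B + \<bar>y t\<bar> \<le> A"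
  shows "\<zeta> * sq_regret y forecast (expert a) {a..<a + m}
           \<le> ln (weight (a + m) a) + ln (real (a + m))"
  using assms(4)
proof (induction m)
  case 0
  then show ?case using assms(1) by (simp add: sq_regret_def weight_self ln_div)
next
  case (Suc m)
  define t where "t = a + m"
  have t_bounds: "t \<ge> 1" "a \<in> {1..t}" using assms(1) by (auto simp: t_def)
  have "mixture t \<le> exp (- \<zeta> * (y t - forecast t)\<^sup>2)"
    using Suc.prems[of t] t_bounds
    by (intro mixture_le_exp_forecast_loss[OF _ _ exp_concave]) (auto simp: t_def)
  then have "ln (mixture t) \<le> - \<zeta> * (y t - forecast t)\<^sup>2"
    using mixture_pos[OF t_bounds(1)] by (metis exp_gt_zero ln_exp ln_le_cancel_iff)
  then have "\<zeta> * ((y t - forecast t)\<^sup>2 - (y t - expert a t)\<^sup>2)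
      \<le> ln (weight (Suc t) a) + ln (real (Suc t)) - (ln (weight t a) + ln (real t))"
    unfolding ln_weight_Suc[OF t_bounds(2)] by (simp add: algebra_simps)
  moreover have "\<zeta> * sq_regret y forecast (expert a) {a..<t} \<le> ln (weight t a) + ln (real t)"
    using Suc by (simp add: t_def)
  ultimately have "\<zeta> * sq_regret y forecast (expert a) {a..<Suc t}
      \<le> ln (weight (Suc t) a) + ln (real (Suc t))"
    by (simp add: sq_regret_def t_def distrib_left del: flh_weights.simps)
  then show ?case by (simp add: t_def)
qed

lemma interval_regret:
  assumes A_pos: "A > 0" and rate: "\<zeta> = 1 / (2 * A\<^sup>2)"
    and target: "\<And>t. t \<in> {1..n} \<Longrightarrow> B + \<bar>y t\<bar> \<le> A"
    and interval: "1 \<le> a" "a \<le> b" "b \<le> n" and u_bounded: "\<bar>u\<bar> \<le> B"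
  shows "sq_regret y forecast (\<lambda>_. u) {a..b} \<le> 3 * A\<^sup>2 * (1 + ln (real n))"
proof -
  have "\<zeta> * sq_regret y forecast (expert a) {a..<a + (Suc b - a)}
      \<le> ln (weight (a + (Suc b - a)) a) + ln (real (a + (Suc b - a)))"
    by (rule regret_against_expert[where A = A]) (use A_pos rate target interval in auto)
  then have "\<zeta> * sq_regret y forecast (expert a) {a..b} \<le> ln (weight (Suc b) a) + ln (real (Suc b))"
    using interval by (simp add: atLeastLessThanSuc_atLeastAtMost del: flh_weights.simps)
  also have "ln (weight (Suc b) a) \<le> 0"
    using weight_le_one[of a "Suc b"] weight_pos[of a "Suc b"] interval by simp
  also have "ln (real (Suc b)) \<le> ln (2 * real n)" using interval by simp
  also have "\<dots> \<le> 1 + ln (real n)"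
    using ln_le_minus_one[of "2 :: real"] interval by (simp add: ln_mult)
  finally have "sq_regret y forecast (expert a) {a..b} \<le> 2 * A\<^sup>2 * (1 + ln (real n))"
    using A_pos by (simp add: rate field_simps)
  moreover have "sq_regret y (expert a) (\<lambda>_. u) {a..b} \<le> A\<^sup>2 * (1 + ln (real (Suc b - a)))"
    using target interval by (intro ogd_base_regret start_bound u_bounded) auto
  moreover have "A\<^sup>2 * (1 + ln (real (Suc b - a))) \<le> A\<^sup>2 * (1 + ln (real n))"
    using interval by (intro mult_left_mono) auto
  ultimately show ?thesis
    unfolding sq_regret_trans[of y forecast "\<lambda>_. u" _ "expert a"] by linarith
qed

end

section \<open>Total variation and the fused lasso\<close>

definition total_variation :: "(nat \<Rightarrow> real) \<Rightarrow> nat \<Rightarrow> nat \<Rightarrow> real" where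
  "total_variation w a b = (\<Sum>t\<in>{a..<b}. \<bar>w (Suc t) - w t\<bar>)"

lemma total_variation_nonneg: "total_variation w a b \<ge> 0"
  by (simp add: total_variation_def sum_nonneg)

lemma total_variation_split:
  "a \<le> b \<Longrightarrow> b \<le> c \<Longrightarrow> total_variation w a c = total_variation w a b + total_variation w b c"
  by (simp add: total_variation_def sum.atLeastLessThan_concat)

lemma total_variation_Suc_right:
  "a \<le> b \<Longrightarrow> total_variation w a (Suc b) = total_variation w a b + \<bar>w (Suc b) - w b\<bar>"
  by (simp add: total_variation_def)

lemma total_variation_Suc_left:
  "a < b \<Longrightarrow> total_variation w a b = \<bar>w (Suc a) - w a\<bar> + total_variation w (Suc a) b"
  by (simp add: total_variation_def sum.atLeast_Suc_lessThan)

lemma total_variation_cong: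
  "(\<And>t. t \<in> {a..b} \<Longrightarrow> w t = z t) \<Longrightarrow> total_variation w a b = total_variation z a b"
  unfolding total_variation_def by (intro sum.cong) auto

lemma total_variation_le:
  assumes "\<And>t. t \<in> {a..b} \<Longrightarrow> \<bar>w t\<bar> \<le> B"
  shows "total_variation w a b \<le> 2 * B * real (b - a)"
proof -
  have "total_variation w a b \<le> (\<Sum>t\<in>{a..<b}. 2 * B)"
    unfolding total_variation_def
  proof (intro sum_mono)
    fix t assume "t \<in> {a..<b}"
    then show "\<bar>w (Suc t) - w t\<bar> \<le> 2 * B" using assms[of t] assms[of "Suc t"] by auto
  qed
  then show ?thesis by (simp add: mult.commute)
qed

definition fused_lasso :: "nat \<Rightarrow> real \<Rightarrow> (nat \<Rightarrow> real) \<Rightarrow> (nat \<Rightarrow> real) \<Rightarrow> real" where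
  "fused_lasso n \<mu> y w = (\<Sum>t\<in>{1..n}. (y t - w t)\<^sup>2) + \<mu> * total_variation w 1 n"

definition is_fused_lasso_min :: "nat \<Rightarrow> real \<Rightarrow> real \<Rightarrow> (nat \<Rightarrow> real) \<Rightarrow> (nat \<Rightarrow> real) \<Rightarrow> bool" where
  "is_fused_lasso_min n B \<mu> y = is_arg_min (fused_lasso n \<mu> y) (\<lambda>w. \<forall>t\<in>{1..n}. \<bar>w t\<bar> \<le> B)"

lemma fused_lasso_min_bounded: "is_fused_lasso_min n B \<mu> y w \<Longrightarrow> t \<in> {1..n} \<Longrightarrow> \<bar>w t\<bar> \<le> B"
  by (simp add: is_fused_lasso_min_def is_arg_min_linorder)

lemma fused_lasso_min_le:
  "is_fused_lasso_min n B \<mu> y w \<Longrightarrow> (\<And>t. t \<in> {1..n} \<Longrightarrow> \<bar>z t\<bar> \<le> B)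
    \<Longrightarrow> fused_lasso n \<mu> y w \<le> fused_lasso n \<mu> y z"
  by (simp add: is_fused_lasso_min_def is_arg_min_linorder)

lemma fused_lasso_cong:
  assumes "\<And>t. t \<in> {1..n} \<Longrightarrow> w t = z t"
  shows "fused_lasso n \<mu> y w = fused_lasso n \<mu> y z"
  unfolding fused_lasso_def using assms total_variation_cong[of 1 n w z] by simp

lemma fused_lasso_diff:
  "fused_lasso n \<mu> y z - fused_lasso n \<mu> y w
    = sq_regret y z w {1..n} + \<mu> * (total_variation z 1 n - total_variation w 1 n)"
  by (simp add: fused_lasso_def sq_regret_def sum_subtractf right_diff_distrib)

lemma fused_lasso_min_exists:
  assumes "B \<ge> 0"
  obtains w where "is_fused_lasso_min n B \<mu> y w"
proof -
  define T :: "(nat \<Rightarrow> real) set" where "T = PiE UNIV (\<lambda>t. if t \<in> {1..n} then {-B..B} else {0})"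
  have "compactin (product_topology (\<lambda>_. euclidean) UNIV) T"
    unfolding T_def by (auto simp: compactin_PiE)
  then have "compact T" by (simp add: euclidean_product_topology)
  moreover have "T \<noteq> {}" unfolding T_def PiE_eq_empty_iff using assms by auto
  moreover have "continuous_on T (fused_lasso n \<mu> y)"
    unfolding fused_lasso_def total_variation_def
    by (intro continuous_intros continuous_on_subset[OF continuous_on_product_coordinates]) auto
  ultimately obtain w where w_mem: "w \<in> T"
      and w_min: "\<And>z. z \<in> T \<Longrightarrow> fused_lasso n \<mu> y w \<le> fused_lasso n \<mu> y z"
    using continuous_attains_inf by metis
  have "fused_lasso n \<mu> y w \<le> fused_lasso n \<mu> y z" if z_bounded: "\<forall>t\<in>{1..n}. \<bar>z t\<bar> \<le> B" for z
  proof -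
    have "(\<lambda>t. if t \<in> {1..n} then z t else 0) \<in> T"
      using z_bounded by (auto simp: T_def abs_le_iff minus_le_iff)
    then show ?thesis
      using w_min fused_lasso_cong[of n "\<lambda>t. if t \<in> {1..n} then z t else 0" z] by fastforce
  qed
  moreover have "\<bar>w t\<bar> \<le> B" if "t \<in> {1..n}" for t
  proof -
    have "w t \<in> (if t \<in> {1..n} then {-B..B} else {0})" using w_mem by (auto simp: T_def PiE_iff)
    then show ?thesis using that by auto
  qed
  ultimately show thesis
    by (intro that) (auto simp: is_fused_lasso_min_def is_arg_min_linorder)
qed

definition dilate :: "real \<Rightarrow> real \<Rightarrow> nat set \<Rightarrow> (nat \<Rightarrow> real) \<Rightarrow> nat \<Rightarrow> real" where
  "dilate \<eta> u I w t = (if t \<in> I then w t + \<eta> * (w t - u) else w t)"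

text \<open>A dilation away from \<open>u\<close> keeps \<open>w\<close> in the box only if \<open>u\<close> is each end of the box that \<open>w\<close>
  touches on \<open>I\<close>.\<close>
definition dilation_center :: "real \<Rightarrow> nat set \<Rightarrow> (nat \<Rightarrow> real) \<Rightarrow> real \<Rightarrow> bool" where
  "dilation_center B I w u \<longleftrightarrow> \<bar>u\<bar> \<le> B \<and> (\<forall>t\<in>I. (w t = B \<longrightarrow> u = B) \<and> (w t = - B \<longrightarrow> u = - B))"

lemma dilation_center_exists:
  assumes "\<epsilon> < B" "a \<in> I" and near: "\<And>t. t \<in> I \<Longrightarrow> \<bar>w t - w a\<bar> \<le> \<epsilon> \<and> \<bar>w t\<bar> \<le> B"
  obtains u where "dilation_center B I w u" "\<bar>w a - u\<bar> \<le> \<epsilon>"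
    "w a < u \<Longrightarrow> B \<le> w a + \<epsilon>" "u < w a \<Longrightarrow> w a - \<epsilon> \<le> - B"
proof -
  have start: "\<bar>w a\<bar> \<le> B" "0 \<le> \<epsilon>" using near[of a] assms(2) by auto
  have not_both: False if "t \<in> I" "w t = B" "t' \<in> I" "w t' = - B" for t t'
    using near[OF that(1)] near[OF that(3)] that assms(1) by linarith
  consider (upper) t where "t \<in> I" "w t = B" | (lower) t where "t \<in> I" "w t = - B"
    | (interior) "\<And>t. t \<in> I \<Longrightarrow> w t \<noteq> B \<and> w t \<noteq> - B" by blast
  then show thesis
  proof cases
    case upper
    show thesis
      by (rule that[of B])
        (use upper near[OF upper(1)] start not_both[OF upper]
          in \<open>auto simp: dilation_center_def abs_le_iff\<close>)
  next
    case lower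
    show thesis
      by (rule that[of "- B"])
        (use lower near[OF lower(1)] start not_both[OF _ _ lower]
          in \<open>auto simp: dilation_center_def abs_le_iff\<close>)
  next
    case interior
    show thesis by (rule that[of "w a"]) (use interior start in \<open>auto simp: dilation_center_def\<close>)
  qed
qed

lemma eventually_abs_mult_le_at_right:
  fixes c d :: real
  assumes "d > 0"
  shows "\<forall>\<^sub>F \<eta> in at_right 0. \<bar>\<eta> * c\<bar> \<le> d"
proof -
  have "((\<lambda>\<eta>. \<bar>\<eta> * c\<bar>) \<longlongrightarrow> \<bar>0 * c\<bar>) (at_right 0)"
    by (intro tendsto_intros)
  then have "\<forall>\<^sub>F \<eta> in at_right 0. \<bar>\<eta> * c\<bar> < d"
    using assms by (intro order_tendstoD(2)) auto
  then show ?thesis by eventually_elim simp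
qed

lemma eventually_dilate_bounded:
  assumes "finite T" and bounded: "\<And>t. t \<in> T \<Longrightarrow> \<bar>w t\<bar> \<le> B" and "dilation_center B I w u"
  shows "\<forall>\<^sub>F \<eta> in at_right 0. \<forall>t\<in>T. \<bar>dilate \<eta> u I w t\<bar> \<le> B"
proof (intro eventually_ball_finite ballI assms(1))
  fix t assume mem: "t \<in> T"
  show "\<forall>\<^sub>F \<eta> in at_right 0. \<bar>dilate \<eta> u I w t\<bar> \<le> B"
  proof (cases "\<bar>w t\<bar> = B \<or> t \<notin> I")
    case True
    then have "w t = u \<or> t \<notin> I"
      using assms(3) by (auto simp: dilation_center_def abs_if split: if_splits)
    then show ?thesis using bounded[OF mem] by (auto simp: dilate_def)
  next
    case False
    then have "B - \<bar>w t\<bar> > 0" using bounded[OF mem] by simp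
    then have "\<forall>\<^sub>F \<eta> in at_right 0. \<bar>\<eta> * (w t - u)\<bar> \<le> B - \<bar>w t\<bar>"
      by (rule eventually_abs_mult_le_at_right)
    then show ?thesis by eventually_elim (auto simp: dilate_def)
  qed
qed

lemma sq_regret_dilate:
  assumes "finite T" "I \<subseteq> T"
  shows "sq_regret y (dilate \<eta> u I w) w T
    = \<eta>\<^sup>2 * (\<Sum>t\<in>I. (w t - u)\<^sup>2) - 2 * \<eta> * (\<Sum>t\<in>I. (y t - w t) * (w t - u))"
proof -
  have "sq_regret y (dilate \<eta> u I w) w T = sq_regret y (dilate \<eta> u I w) w I"
    unfolding sq_regret_def using assms by (intro sum.mono_neutral_right) (auto simp: dilate_def)
  also have "\<dots> = (\<Sum>t\<in>I. \<eta>\<^sup>2 * (w t - u)\<^sup>2 - 2 * \<eta> * ((y t - w t) * (w t - u)))"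
    unfolding sq_regret_def
    by (intro sum.cong) (auto simp: dilate_def power2_eq_square algebra_simps)
  finally show ?thesis by (simp add: sum_subtractf sum_distrib_left)
qed

definition exit_sign :: "nat \<Rightarrow> (nat \<Rightarrow> real) \<Rightarrow> nat \<Rightarrow> real" where
  "exit_sign n w b = (if b < n then sgn (w (Suc b) - w b) else 0)"

lemma total_variation_dilate_entry:
  assumes "m \<le> a" "a \<le> b" "\<eta> \<ge> 0"
  shows "total_variation (dilate \<eta> u {a..b} w) m a \<le> total_variation w m a + \<eta> * \<bar>w a - u\<bar>"
proof (cases "m = a")
  case True
  then show ?thesis using assms by (simp add: total_variation_def)
next
  case False
  then obtain k where a_eq: "a = Suc k" "m \<le> k" using assms(1) by (cases a) auto
  have "total_variation (dilate \<eta> u {a..b} w) m k = total_variation w m k"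
    using a_eq by (intro total_variation_cong) (auto simp: dilate_def)
  moreover have "\<bar>dilate \<eta> u {a..b} w (Suc k) - dilate \<eta> u {a..b} w k\<bar>
      = \<bar>(w (Suc k) - w k) + \<eta> * (w a - u)\<bar>"
    using a_eq assms by (simp add: dilate_def)
  moreover have "\<dots> \<le> \<bar>w (Suc k) - w k\<bar> + \<eta> * \<bar>w a - u\<bar>"
    using abs_triangle_ineq[of "w (Suc k) - w k" "\<eta> * (w a - u)"] assms by (simp add: abs_mult)
  ultimately show ?thesis using a_eq by (simp add: total_variation_Suc_right)
qed

lemma total_variation_dilate_bin:
  assumes "\<eta> \<ge> 0"
  shows "total_variation (dilate \<eta> u {a..b} w) a b = (1 + \<eta>) * total_variation w a b"
  unfolding total_variation_def sum_distrib_left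
proof (intro sum.cong refl)
  fix t assume "t \<in> {a..<b}"
  then have "dilate \<eta> u {a..b} w (Suc t) - dilate \<eta> u {a..b} w t = (1 + \<eta>) * (w (Suc t) - w t)"
    by (simp add: dilate_def algebra_simps)
  then show "\<bar>dilate \<eta> u {a..b} w (Suc t) - dilate \<eta> u {a..b} w t\<bar> = (1 + \<eta>) * \<bar>w (Suc t) - w t\<bar>"
    using assms by (simp add: abs_mult)
qed

lemma total_variation_dilate_exit:
  assumes "a \<le> b" "b \<le> n" and small: "b < n \<Longrightarrow> \<bar>\<eta> * (w b - u)\<bar> \<le> \<bar>w (Suc b) - w b\<bar>"
  shows "total_variation (dilate \<eta> u {a..b} w) b n
    = total_variation w b n - \<eta> * (exit_sign n w b * (w b - u))"
proof (cases "b < n")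
  case True
  have "total_variation (dilate \<eta> u {a..b} w) (Suc b) n = total_variation w (Suc b) n"
    by (intro total_variation_cong) (auto simp: dilate_def)
  moreover have "dilate \<eta> u {a..b} w (Suc b) - dilate \<eta> u {a..b} w b
      = w (Suc b) - w b - \<eta> * (w b - u)"
    using assms(1) by (simp add: dilate_def)
  moreover have "\<bar>w (Suc b) - w b - \<eta> * (w b - u)\<bar>
      = \<bar>w (Suc b) - w b\<bar> - sgn (w (Suc b) - w b) * (\<eta> * (w b - u))"
    using small[OF True] by (auto simp: sgn_if abs_if split: if_splits)
  ultimately show ?thesis
    using True by (simp add: total_variation_Suc_left exit_sign_def)
qed (use assms in \<open>auto simp: total_variation_def exit_sign_def\<close>)

lemma total_variation_dilate_le:
  assumes "m \<le> a" "a \<le> b" "b \<le> n" "\<eta> \<ge> 0"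
    and "b < n \<Longrightarrow> \<bar>\<eta> * (w b - u)\<bar> \<le> \<bar>w (Suc b) - w b\<bar>"
  shows "total_variation (dilate \<eta> u {a..b} w) m n \<le> total_variation w m n
    + \<eta> * (total_variation w a b + \<bar>w a - u\<bar> - exit_sign n w b * (w b - u))"
proof -
  have split: "total_variation z m n
      = total_variation z m a + total_variation z a b + total_variation z b n" for z
    using assms total_variation_split[of m a n z] total_variation_split[of a b n z] by simp
  show ?thesis
    using total_variation_dilate_entry[of m a b \<eta> u w] total_variation_dilate_bin[of \<eta> u a b w]
      total_variation_dilate_exit[of a b n \<eta> w u] assms
    unfolding split by (simp add: algebra_simps)
qed

text \<open>First-order optimality of \<open>w\<close> in the direction of the dilation, as \<open>\<eta> \<down> 0\<close>.\<close>
lemma fused_lasso_min_dilation: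
  assumes min: "is_fused_lasso_min n B \<mu> y w" and "\<mu> \<ge> 0"
    and bin: "1 \<le> a" "a \<le> b" "b \<le> n" and center: "dilation_center B {a..b} w u"
    and jump: "b < n \<Longrightarrow> w (Suc b) \<noteq> w b"
  shows "2 * (\<Sum>t\<in>{a..b}. (y t - w t) * (w t - u))
           \<le> \<mu> * (total_variation w a b + \<bar>w a - u\<bar> - exit_sign n w b * (w b - u))"
proof -
  define P where "P = (\<Sum>t\<in>{a..b}. (y t - w t) * (w t - u))"
  define Q where "Q = (\<Sum>t\<in>{a..b}. (w t - u)\<^sup>2)"
  define V where "V = total_variation w a b + \<bar>w a - u\<bar> - exit_sign n w b * (w b - u)"
  have bounded: "\<forall>\<^sub>F \<eta> in at_right 0. \<forall>t\<in>{1..n}. \<bar>dilate \<eta> u {a..b} w t\<bar> \<le> B"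
    using center fused_lasso_min_bounded[OF min] by (intro eventually_dilate_bounded) auto
  have small: "\<forall>\<^sub>F \<eta> in at_right 0. b < n \<longrightarrow> \<bar>\<eta> * (w b - u)\<bar> \<le> \<bar>w (Suc b) - w b\<bar>"
    using jump by (cases "b < n") (auto intro: eventually_abs_mult_le_at_right)
  have "\<forall>\<^sub>F \<eta> in at_right 0. 0 \<le> \<mu> * V - 2 * P + \<eta> * Q"
    using bounded small eventually_at_right_less[of "0::real"]
  proof eventually_elim
    case (elim \<eta>)
    let ?z = "dilate \<eta> u {a..b} w"
    have "total_variation ?z 1 n - total_variation w 1 n \<le> \<eta> * V"
      using total_variation_dilate_le[of 1 a b n \<eta> w u] bin elim by (simp add: V_def)
    then have "\<mu> * (total_variation ?z 1 n - total_variation w 1 n) \<le> \<mu> * (\<eta> * V)"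
      using \<open>\<mu> \<ge> 0\<close> by (rule mult_left_mono)
    moreover have "0 \<le> fused_lasso n \<mu> y ?z - fused_lasso n \<mu> y w"
      using fused_lasso_min_le[OF min] elim(1) by simp
    moreover have "sq_regret y ?z w {1..n} = \<eta>\<^sup>2 * Q - 2 * \<eta> * P"
      unfolding P_def Q_def using bin by (intro sq_regret_dilate) auto
    ultimately have "0 \<le> \<eta> * (\<mu> * V - 2 * P + \<eta> * Q)"
      unfolding fused_lasso_diff by (simp add: algebra_simps power2_eq_square)
    then show ?case using elim(3) by (simp add: zero_le_mult_iff)
  qed
  moreover have "((\<lambda>\<eta>. \<mu> * V - 2 * P + \<eta> * Q) \<longlongrightarrow> \<mu> * V - 2 * P + 0 * Q) (at_right 0)"
    by (intro tendsto_intros)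
  ultimately have "0 \<le> \<mu> * V - 2 * P + 0 * Q"
    by (intro tendsto_lowerbound) auto
  then show ?thesis by (simp add: P_def V_def)
qed

section \<open>From interval regret to dynamic regret\<close>

lemma first_failure_cases:
  fixes a n :: nat
  assumes "P a"
  obtains (none) "\<And>t. t \<in> {a..n} \<Longrightarrow> P t"
    | (exit) b where "a \<le> b" "b < n" "\<And>t. t \<in> {a..b} \<Longrightarrow> P t" "\<not> P (Suc b)"
proof (cases "\<exists>t. t \<in> {a..n} \<and> \<not> P t")
  case True
  define c where "c = (LEAST t. t \<in> {a..n} \<and> \<not> P t)"
  have failure: "c \<in> {a..n}" "\<not> P c"
    using LeastI_ex[OF True] by (auto simp: c_def)
  have before: "P t" if "t \<in> {a..<c}" for t
    using not_less_Least[of t "\<lambda>t. t \<in> {a..n} \<and> \<not> P t", folded c_def] that failure by auto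
  have "a < c" using failure assms by (cases "a = c") auto
  then obtain b where "c = Suc b" "a \<le> b" by (cases c) auto
  then show thesis using failure before by (intro exit[of b]) auto
qed (use none in blast)

text \<open>Here \<open>p\<close> and \<open>q\<close> are the first and last values on a bin and \<open>r\<close> is the value after it. The
  center \<open>u\<close> never lies on the exit side of \<open>p\<close>: otherwise the box ends within \<open>\<epsilon>\<close> of \<open>p\<close> on that
  side, which leaves no room for \<open>r\<close>.\<close>
lemma exit_jump_saving:
  fixes p q r u :: real
  assumes "\<bar>q - p\<bar> \<le> \<epsilon>" "\<bar>r - p\<bar> > \<epsilon>" "\<bar>r\<bar> \<le> B"
    and "p < u \<Longrightarrow> B \<le> p + \<epsilon>" "u < p \<Longrightarrow> p - \<epsilon> \<le> - B"
  shows "\<bar>p - u\<bar> - sgn (r - q) * (q - u) \<le> \<bar>r - q\<bar> - \<epsilon>"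
proof (cases "r > p")
  case True
  then have "u \<le> p" using assms(2-4) by linarith
  moreover have "r > q" "r - p > \<epsilon>" using True assms(1,2) by linarith+
  ultimately show ?thesis by simp
next
  case False
  then have "u \<ge> p" using assms(2,3,5) by linarith
  moreover have "r < q" "p - r > \<epsilon>" using False assms(1,2) by linarith+
  ultimately show ?thesis by simp
qed

lemma sq_regret_const_le:
  fixes y w :: "'a \<Rightarrow> real"
  assumes "\<And>t. t \<in> I \<Longrightarrow> \<bar>w t - u\<bar> \<le> \<delta>"
  shows "sq_regret y (\<lambda>_. u) w I \<le> \<delta>\<^sup>2 * real (card I) + 2 * (\<Sum>t\<in>I. (y t - w t) * (w t - u))"
proof -
  have "sq_regret y (\<lambda>_. u) w I = (\<Sum>t\<in>I. (w t - u)\<^sup>2 + 2 * ((y t - w t) * (w t - u)))"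
    unfolding sq_regret_def by (intro sum.cong) (auto simp: power2_eq_square algebra_simps)
  also have "\<dots> = (\<Sum>t\<in>I. (w t - u)\<^sup>2) + 2 * (\<Sum>t\<in>I. (y t - w t) * (w t - u))"
    by (simp add: sum.distrib sum_distrib_left)
  also have "(\<Sum>t\<in>I. (w t - u)\<^sup>2) \<le> (\<Sum>t\<in>I. \<delta>\<^sup>2)"
    using assms by (intro sum_mono abs_le_square_iff[THEN iffD1]) force
  finally show ?thesis by (simp add: mult.commute)
qed

locale interval_regret_bound =
  fixes n :: nat and B L :: real and x y :: "nat \<Rightarrow> real"
  assumes L_nonneg: "L \<ge> 0"
    and interval_regret: "1 \<le> a \<Longrightarrow> a \<le> b \<Longrightarrow> b \<le> n \<Longrightarrow> \<bar>u\<bar> \<le> B \<Longrightarrow> sq_regret y x (\<lambda>_. u) {a..b} \<le> L"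
begin

context
  fixes \<epsilon> :: real and w :: "nat \<Rightarrow> real"
  assumes eps: "0 < \<epsilon>" "\<epsilon> < B" and min: "is_fused_lasso_min n B (L / \<epsilon>) y w"
begin

lemma penalty_nonneg: "L / \<epsilon> \<ge> 0"
  using L_nonneg eps by simp

lemma bin_regret_le:
  assumes bin: "1 \<le> a" "a \<le> b" "b \<le> n" "\<And>t. t \<in> {a..b} \<Longrightarrow> \<bar>w t - w a\<bar> \<le> \<epsilon>"
    and center: "dilation_center B {a..b} w u" "\<bar>w a - u\<bar> \<le> \<epsilon>"
    and jump: "b < n \<Longrightarrow> w (Suc b) \<noteq> w b"
  shows "sq_regret y x w {a..b} \<le> L + 4 * \<epsilon>\<^sup>2 * real (Suc b - a)
    + L / \<epsilon> * (total_variation w a b + \<bar>w a - u\<bar> - exit_sign n w b * (w b - u))"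
proof -
  have "\<bar>w t - u\<bar> \<le> 2 * \<epsilon>" if "t \<in> {a..b}" for t
    using bin(4)[OF that] center(2) by linarith
  then have "sq_regret y (\<lambda>_. u) w {a..b}
      \<le> (2 * \<epsilon>)\<^sup>2 * real (card {a..b}) + 2 * (\<Sum>t\<in>{a..b}. (y t - w t) * (w t - u))"
    by (rule sq_regret_const_le)
  moreover have "2 * (\<Sum>t\<in>{a..b}. (y t - w t) * (w t - u))
      \<le> L / \<epsilon> * (total_variation w a b + \<bar>w a - u\<bar> - exit_sign n w b * (w b - u))"
    by (rule fused_lasso_min_dilation[OF min penalty_nonneg bin(1-3) center(1) jump])
  moreover have "sq_regret y x (\<lambda>_. u) {a..b} \<le> L"
    using interval_regret[OF bin(1-3)] center(1) by (simp add: dilation_center_def)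
  moreover have "(2 * \<epsilon>)\<^sup>2 * real (card {a..b}) = 4 * \<epsilon>\<^sup>2 * real (Suc b - a)"
    by (simp add: power_mult_distrib)
  ultimately show ?thesis
    unfolding sq_regret_trans[of y x w _ "\<lambda>_. u"] by linarith
qed

lemma last_bin_regret_le:
  assumes "1 \<le> a" "a \<le> n" and bin: "\<And>t. t \<in> {a..n} \<Longrightarrow> \<bar>w t - w a\<bar> \<le> \<epsilon>"
  shows "sq_regret y x w {a..n}
    \<le> L / \<epsilon> * total_variation w a n + 4 * \<epsilon>\<^sup>2 * real (Suc n - a) + 2 * L"
proof -
  obtain u where center: "dilation_center B {a..n} w u" "\<bar>w a - u\<bar> \<le> \<epsilon>"
    by (rule dilation_center_exists[of \<epsilon> B a "{a..n}" w])
      (use eps bin fused_lasso_min_bounded[OF min] assms in auto)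
  have "sq_regret y x w {a..n} \<le> L + 4 * \<epsilon>\<^sup>2 * real (Suc n - a)
      + L / \<epsilon> * (total_variation w a n + \<bar>w a - u\<bar> - exit_sign n w n * (w n - u))"
    by (rule bin_regret_le) (use assms center in auto)
  also have "\<dots> \<le> L + 4 * \<epsilon>\<^sup>2 * real (Suc n - a) + L / \<epsilon> * (total_variation w a n + \<epsilon>)"
    using center(2) by (intro add_left_mono mult_left_mono penalty_nonneg) (simp add: exit_sign_def)
  also have "\<dots> = L / \<epsilon> * total_variation w a n + 4 * \<epsilon>\<^sup>2 * real (Suc n - a) + 2 * L"
    using eps by (simp add: field_simps)
  finally show ?thesis .
qed

text \<open>The saving \<open>L / \<epsilon> * \<epsilon>\<close> at the exit jump cancels the interval regret \<open>L\<close> of the bin.\<close>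
lemma exited_bin_regret_le:
  assumes "1 \<le> a" "a \<le> b" "b < n" and bin: "\<And>t. t \<in> {a..b} \<Longrightarrow> \<bar>w t - w a\<bar> \<le> \<epsilon>"
    and exit: "\<bar>w (Suc b) - w a\<bar> > \<epsilon>"
  shows "sq_regret y x w {a..b}
    \<le> L / \<epsilon> * total_variation w a (Suc b) + 4 * \<epsilon>\<^sup>2 * real (Suc b - a)"
proof -
  have bounded: "\<bar>w t\<bar> \<le> B" if "t \<in> {a..Suc b}" for t
    using fused_lasso_min_bounded[OF min] that assms by auto
  obtain u where center: "dilation_center B {a..b} w u" "\<bar>w a - u\<bar> \<le> \<epsilon>"
      "w a < u \<Longrightarrow> B \<le> w a + \<epsilon>" "u < w a \<Longrightarrow> w a - \<epsilon> \<le> - B"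
    by (rule dilation_center_exists[of \<epsilon> B a "{a..b}" w]) (use eps bin bounded assms in auto)
  have last_near: "\<bar>w b - w a\<bar> \<le> \<epsilon>" using bin assms by simp
  have jump: "w (Suc b) \<noteq> w b" using last_near exit by auto
  have "\<bar>w a - u\<bar> - sgn (w (Suc b) - w b) * (w b - u) \<le> \<bar>w (Suc b) - w b\<bar> - \<epsilon>"
    by (rule exit_jump_saving[OF last_near exit _ center(3,4)]) (use bounded assms in auto)
  then have saving: "total_variation w a b + \<bar>w a - u\<bar> - exit_sign n w b * (w b - u)
      \<le> total_variation w a (Suc b) - \<epsilon>"
    using assms by (simp add: exit_sign_def total_variation_Suc_right)
  have "sq_regret y x w {a..b} \<le> L + 4 * \<epsilon>\<^sup>2 * real (Suc b - a)
      + L / \<epsilon> * (total_variation w a b + \<bar>w a - u\<bar> - exit_sign n w b * (w b - u))"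
    by (rule bin_regret_le) (use assms center jump in auto)
  also have "\<dots> \<le> L + 4 * \<epsilon>\<^sup>2 * real (Suc b - a) + L / \<epsilon> * (total_variation w a (Suc b) - \<epsilon>)"
    using saving by (intro add_left_mono mult_left_mono penalty_nonneg)
  also have "\<dots> = L / \<epsilon> * total_variation w a (Suc b) + 4 * \<epsilon>\<^sup>2 * real (Suc b - a)"
    using eps by (simp add: field_simps)
  finally show ?thesis .
qed

lemma fused_lasso_min_regret_le:
  assumes "1 \<le> a" "a \<le> n"
  shows "sq_regret y x w {a..n}
    \<le> L / \<epsilon> * total_variation w a n + 4 * \<epsilon>\<^sup>2 * real (Suc n - a) + 2 * L"
  using assms
proof (induction "n - a" arbitrary: a rule: less_induct)
  case less
  have "\<bar>w a - w a\<bar> \<le> \<epsilon>" using eps by simp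
  then show ?case
  proof (cases rule: first_failure_cases[where P = "\<lambda>t. \<bar>w t - w a\<bar> \<le> \<epsilon>" and n = n])
    case none
    then show ?thesis using less.prems by (intro last_bin_regret_le)
  next
    case (exit b)
    have "sq_regret y x w {a..b}
        \<le> L / \<epsilon> * total_variation w a (Suc b) + 4 * \<epsilon>\<^sup>2 * real (Suc b - a)"
      using exit less.prems by (intro exited_bin_regret_le) auto
    moreover have "sq_regret y x w {Suc b..n}
        \<le> L / \<epsilon> * total_variation w (Suc b) n + 4 * \<epsilon>\<^sup>2 * real (Suc n - Suc b) + 2 * L"
      using exit less.prems by (intro less.hyps) auto
    moreover have "sq_regret y x w {a..n} = sq_regret y x w {a..b} + sq_regret y x w {Suc b..n}"
      using exit by (intro sq_regret_split) auto
    moreover have "L / \<epsilon> * total_variation w a n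
        = L / \<epsilon> * total_variation w a (Suc b) + L / \<epsilon> * total_variation w (Suc b) n"
      using total_variation_split[of a "Suc b" n w] exit by (simp add: distrib_left)
    moreover have "real (Suc n - a) = real (Suc b - a) + real (Suc n - Suc b)"
      using exit by (simp add: of_nat_diff)
    then have "4 * \<epsilon>\<^sup>2 * real (Suc n - a)
        = 4 * \<epsilon>\<^sup>2 * real (Suc b - a) + 4 * \<epsilon>\<^sup>2 * real (Suc n - Suc b)"
      by (simp only: distrib_left)
    ultimately show ?thesis by linarith
  qed
qed

end

lemma dynamic_regret_le:
  assumes "0 < \<epsilon>" "\<epsilon> < B" "n \<ge> 1" and v_bounded: "\<And>t. t \<in> {1..n} \<Longrightarrow> \<bar>v t\<bar> \<le> B"
  shows "sq_regret y x v {1..n} \<le> L / \<epsilon> * total_variation v 1 n + 4 * \<epsilon>\<^sup>2 * real n + 2 * L"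
proof -
  obtain w where min: "is_fused_lasso_min n B (L / \<epsilon>) y w"
    by (rule fused_lasso_min_exists[of B n "L / \<epsilon>" y]) (use assms in auto)
  have "0 \<le> fused_lasso n (L / \<epsilon>) y v - fused_lasso n (L / \<epsilon>) y w"
    using fused_lasso_min_le[OF min v_bounded] by simp
  then have "sq_regret y w v {1..n} \<le> L / \<epsilon> * total_variation v 1 n - L / \<epsilon> * total_variation w 1 n"
    unfolding fused_lasso_diff by (simp add: sq_regret_def sum_subtractf right_diff_distrib)
  moreover have "sq_regret y x w {1..n}
      \<le> L / \<epsilon> * total_variation w 1 n + 4 * \<epsilon>\<^sup>2 * real (Suc n - 1) + 2 * L"
    using assms by (intro fused_lasso_min_regret_le min) auto
  ultimately show ?thesis
    unfolding sq_regret_trans[of y x v _ w] by simp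
qed

end

lemma bin_width_exists:
  fixes B C :: real
  assumes B_pos: "B > 0" and n_ge_1: "n \<ge> 1" and C_bounds: "0 \<le> C" "C \<le> 2 * B * real n"
  defines "\<rho> \<equiv> root 3 (real n * C\<^sup>2 / (4 * B\<^sup>2))"
  obtains \<epsilon> where "0 < \<epsilon>" "\<epsilon> < B" "C / \<epsilon> \<le> 4 * \<rho>" "4 * \<epsilon>\<^sup>2 * real n \<le> B\<^sup>2 * (1 + \<rho>)"
proof -
  define q where "q = root 3 (C / (2 * B * real n))"
  define r where "r = max q (1 / sqrt (real n))"
  have n_pos: "real n > 0" using n_ge_1 by simp
  have q_props: "0 \<le> q" "q \<le> 1" "q ^ 3 = C / (2 * B * real n)"
    using B_pos C_bounds n_pos by (auto simp: q_def)
  have r_bounds: "0 < r" "r \<le> 1" using q_props n_pos by (auto simp: r_def less_max_iff_disj)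
  have "(real n * q\<^sup>2) ^ 3 = real n ^ 3 * (q ^ 3)\<^sup>2"
    by (simp add: power_mult_distrib flip: power_mult)
  also have "\<dots> = real n * C\<^sup>2 / (4 * B\<^sup>2)"
    unfolding q_props(3) using n_pos B_pos by (simp add: field_simps power2_eq_square power3_eq_cube)
  finally have \<rho>_eq: "\<rho> = real n * q\<^sup>2"
    unfolding \<rho>_def by (intro real_root_pos_unique) auto
  show thesis
  proof (rule that[of "B / 2 * r"])
    show "0 < B / 2 * r" using B_pos r_bounds by simp
    show "B / 2 * r < B" using mult_left_mono[OF r_bounds(2), of B] B_pos by linarith
    have "C = 2 * B * real n * (q\<^sup>2 * q)"
      using q_props(3) B_pos n_pos by (simp add: power2_eq_square power3_eq_cube field_simps)
    also have "\<dots> \<le> 2 * B * real n * (q\<^sup>2 * r)"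
      using B_pos by (intro mult_left_mono) (auto simp: r_def)
    finally show "C / (B / 2 * r) \<le> 4 * \<rho>"
      using B_pos r_bounds by (simp add: \<rho>_eq divide_le_eq algebra_simps)
    have "real n * r\<^sup>2 \<le> 1 + real n * q\<^sup>2"
      using n_pos by (cases "q \<le> 1 / sqrt (real n)") (auto simp: r_def max_def power_divide)
    then have "B\<^sup>2 * (real n * r\<^sup>2) \<le> B\<^sup>2 * (1 + \<rho>)"
      unfolding \<rho>_eq by (intro mult_left_mono) auto
    then show "4 * (B / 2 * r)\<^sup>2 * real n \<le> B\<^sup>2 * (1 + \<rho>)"
      by (simp add: power_mult_distrib power_divide algebra_simps)
  qed
qed

text \<open>For \<open>B = 0\<close> the root is \<open>0\<close> by division by zero, and \<open>v\<close> is the constant \<open>0\<close>.\<close>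
lemma (in interval_regret_bound) dynamic_regret_rate:
  assumes n_ge_1: "n \<ge> 1" and v_bounded: "\<And>t. t \<in> {1..n} \<Longrightarrow> \<bar>v t\<bar> \<le> B"
  shows "sq_regret y x v {1..n}
    \<le> (6 * L + B\<^sup>2) * (1 + root 3 (real n * (total_variation v 1 n)\<^sup>2 / (4 * B\<^sup>2)))"
proof (cases "B = 0")
  case True
  then have "sq_regret y x v {1..n} = sq_regret y x (\<lambda>_. 0) {1..n}"
    unfolding sq_regret_def using v_bounded by (intro sum.cong) auto
  also have "\<dots> \<le> L" using n_ge_1 True by (intro interval_regret) auto
  finally show ?thesis using True L_nonneg by simp
next
  case False
  define C where "C = total_variation v 1 n"
  define \<rho> where "\<rho> = root 3 (real n * C\<^sup>2 / (4 * B\<^sup>2))"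
  have B_pos: "B > 0" using v_bounded[of 1] n_ge_1 False by auto
  have "C \<le> 2 * B * real (n - 1)" unfolding C_def using v_bounded by (rule total_variation_le)
  also have "\<dots> \<le> 2 * B * real n" using B_pos by simp
  finally obtain \<epsilon> where width: "0 < \<epsilon>" "\<epsilon> < B" "C / \<epsilon> \<le> 4 * \<rho>" "4 * \<epsilon>\<^sup>2 * real n \<le> B\<^sup>2 * (1 + \<rho>)"
    using bin_width_exists[OF B_pos n_ge_1, of C] total_variation_nonneg
    unfolding C_def \<rho>_def by metis
  have "sq_regret y x v {1..n} \<le> L * (C / \<epsilon>) + 4 * \<epsilon>\<^sup>2 * real n + 2 * L"
    using dynamic_regret_le[OF width(1,2) n_ge_1 v_bounded] by (simp add: C_def)
  also have "\<dots> \<le> L * (4 * \<rho>) + B\<^sup>2 * (1 + \<rho>) + 2 * L"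
    using width L_nonneg by (intro add_mono mult_left_mono) auto
  also have "\<dots> \<le> (6 * L + B\<^sup>2) * (1 + \<rho>)"
    using L_nonneg by (simp add: \<rho>_def algebra_simps)
  finally show ?thesis by (simp add: \<rho>_def C_def)
qed

lemma (in flh_ogd) dynamic_regret:
  assumes A_pos: "A > 0" and rate: "\<zeta> = 1 / (2 * A\<^sup>2)" and n_ge_1: "n \<ge> 1"
    and target: "\<And>t. t \<in> {1..n} \<Longrightarrow> B + \<bar>y t\<bar> \<le> A"
    and v_bounded: "\<And>t. t \<in> {1..n} \<Longrightarrow> \<bar>v t\<bar> \<le> B"
  shows "sq_regret y forecast v {1..n} \<le> (18 * A\<^sup>2 + B\<^sup>2) * (1 + ln (real n))
    * (1 + root 3 (real n * (total_variation v 1 n)\<^sup>2 / (4 * B\<^sup>2)))"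
proof -
  define L where "L = 3 * A\<^sup>2 * (1 + ln (real n))"
  have ln_nonneg: "ln (real n) \<ge> 0" using n_ge_1 by simp
  interpret interval_regret_bound n B L forecast y
    using ln_nonneg interval_regret[OF A_pos rate target] by unfold_locales (auto simp: L_def)
  have "6 * L + B\<^sup>2 \<le> (18 * A\<^sup>2 + B\<^sup>2) * (1 + ln (real n))"
    using ln_nonneg by (simp add: L_def algebra_simps)
  then have "(6 * L + B\<^sup>2) * (1 + root 3 (real n * (total_variation v 1 n)\<^sup>2 / (4 * B\<^sup>2)))
      \<le> (18 * A\<^sup>2 + B\<^sup>2) * (1 + ln (real n))
        * (1 + root 3 (real n * (total_variation v 1 n)\<^sup>2 / (4 * B\<^sup>2)))"
    by (rule mult_right_mono) simp
  with dynamic_regret_rate[OF n_ge_1 v_bounded] show ?thesis by (rule order.trans)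
qed

section \<open>Reduction to the univariate problem\<close>

lemma sum_powr_le_card_powr:
  fixes c :: "'a \<Rightarrow> real"
  assumes nonneg: "\<And>i. i \<in> I \<Longrightarrow> c i \<ge> 0" and exponent: "0 \<le> p" "p \<le> 1"
  shows "(\<Sum>i\<in>I. c i powr p) \<le> real (card I) powr (1 - p) * (\<Sum>i\<in>I. c i) powr p"
proof (cases "finite I \<and> (\<Sum>i\<in>I. c i) \<noteq> 0")
  case False
  then have "infinite I \<or> (\<forall>i\<in>I. c i = 0)"
    using nonneg sum_nonneg_eq_0_iff[of I c] by blast
  then show ?thesis by auto
next
  case True
  define S where "S = (\<Sum>i\<in>I. c i)"
  define N where "N = real (card I)"
  have S_pos: "S > 0" using True sum_nonneg[of I c] nonneg by (auto simp: S_def less_le)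
  have N_pos: "N > 0" using True by (auto simp: N_def card_gt_0_iff)
  have "c i powr p * (S / N) powr (1 - p) \<le> p * c i + (1 - p) * (S / N)" if "i \<in> I" for i
    using Youngs_inequality_0[of p "1 - p" "c i" "S / N"] nonneg[OF that] exponent S_pos N_pos
    by (cases "c i = 0") auto
  then have "(\<Sum>i\<in>I. c i powr p * (S / N) powr (1 - p)) \<le> (\<Sum>i\<in>I. p * c i + (1 - p) * (S / N))"
    by (rule sum_mono)
  also have "\<dots> = p * S + (1 - p) * (N * (S / N))"
    by (simp add: sum.distrib S_def N_def flip: sum_distrib_left)
  also have "\<dots> = S" using N_pos by (simp add: algebra_simps)
  finally have "(\<Sum>i\<in>I. c i powr p) \<le> S / (S / N) powr (1 - p)"
    using S_pos N_pos by (simp add: pos_le_divide_eq flip: sum_distrib_right)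
  also have "\<dots> = N powr (1 - p) * (S powr 1 / S powr (1 - p))"
    using S_pos N_pos by (simp add: powr_divide)
  also have "S powr 1 / S powr (1 - p) = S powr p" using powr_diff[of S 1 "1 - p"] by simp
  finally show ?thesis by (simp add: S_def N_def)
qed

lemma sum_root3_square_le:
  fixes c :: "'a \<Rightarrow> real"
  assumes "\<And>i. i \<in> I \<Longrightarrow> c i \<ge> 0"
  shows "(\<Sum>i\<in>I. root 3 ((c i)\<^sup>2)) \<le> root 3 (real (card I)) * root 3 ((\<Sum>i\<in>I. c i)\<^sup>2)"
proof -
  have root_eq: "root 3 (z\<^sup>2) = z powr (2 / 3)" if "z \<ge> 0" for z :: real
    using that by (simp add: root_powr_inverse powr_powr flip: powr_numeral)
  have "(\<Sum>i\<in>I. root 3 ((c i)\<^sup>2)) = (\<Sum>i\<in>I. c i powr (2 / 3))"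
    using assms root_eq by (intro sum.cong) auto
  also have "\<dots> \<le> real (card I) powr (1 / 3) * (\<Sum>i\<in>I. c i) powr (2 / 3)"
    using sum_powr_le_card_powr[of I c "2 / 3"] assms by simp
  also have "\<dots> = root 3 (real (card I)) * root 3 ((\<Sum>i\<in>I. c i)\<^sup>2)"
    using assms root_eq[of "\<Sum>i\<in>I. c i"] by (simp add: root_powr_inverse sum_nonneg)
  finally show ?thesis .
qed

lemma norminf_d_le_iff: "B \<ge> 0 \<Longrightarrow> norminf_d d x \<le> B \<longleftrightarrow> (\<forall>i<d. \<bar>x i\<bar> \<le> B)"
  by (auto simp: norminf_d_def)

lemma abs_le_norminf_d: "i < d \<Longrightarrow> \<bar>x i\<bar> \<le> norminf_d d x"
  unfolding norminf_d_def by (intro Max_ge) auto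

lemma norm1_d_nonneg: "norm1_d d x \<ge> 0"
  by (simp add: norm1_d_def sum_nonneg)

lemma norminf_d_le_norm1_d: "norminf_d d x \<le> norm1_d d x"
  using norm1_d_nonneg
  by (subst norminf_d_le_iff) (auto simp: norm1_d_def intro!: member_le_sum)

lemma abs_inner_d_le: "\<bar>inner_d d g z\<bar> \<le> norminf_d d g * norm1_d d z"
proof -
  have "\<bar>inner_d d g z\<bar> \<le> (\<Sum>i<d. \<bar>g i * z i\<bar>)" unfolding inner_d_def by (rule sum_abs)
  also have "\<dots> \<le> (\<Sum>i<d. norminf_d d g * \<bar>z i\<bar>)"
    using abs_le_norminf_d by (intro sum_mono) (auto simp: abs_mult intro!: mult_right_mono)
  finally show ?thesis by (simp add: norm1_d_def sum_distrib_left)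
qed

lemma norm1_d_triangle:
  "norm1_d d (\<lambda>i. x i - z i) \<le> norm1_d d (\<lambda>i. x i - y i) + norm1_d d (\<lambda>i. y i - z i)"
  unfolding norm1_d_def sum.distrib[symmetric] by (intro sum_mono) auto

lemma compact_subset_box:
  assumes "compact W" "W \<subseteq> vecs d" "B = (SUP v\<in>W. norminf_d d v)"
  shows "W \<subseteq> box_d d B"
proof
  fix v assume mem: "v \<in> W"
  have "continuous_on W (norm1_d d)"
    unfolding norm1_d_def[abs_def]
    by (intro continuous_on_sum continuous_on_rabs
        continuous_on_subset[OF continuous_on_product_coordinates]) auto
  then have "bdd_above (norm1_d d ` W)"
    using assms(1) by (intro bounded_imp_bdd_above compact_imp_bounded compact_continuous_image)
  then obtain M where "\<And>z. z \<in> W \<Longrightarrow> norm1_d d z \<le> M" by (auto simp: bdd_above_def)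
  then have "bdd_above (norminf_d d ` W)"
    using order.trans[OF norminf_d_le_norm1_d] by (intro bdd_aboveI2[where M = M]) blast
  then have "norminf_d d v \<le> B" unfolding assms(3) using mem by (intro cSUP_upper)
  then show "v \<in> box_d d B" using mem assms(2) by (auto simp: box_d_def)
qed

lemma dist1_set_le: "y \<in> W \<Longrightarrow> dist1_set d W x \<le> norm1_d d (\<lambda>i. x i - y i)"
  unfolding dist1_set_def
  by (rule cINF_lower) (auto intro!: bdd_belowI2[where m = 0] norm1_d_nonneg)

lemma dist1_set_lipschitz:
  assumes "W \<noteq> {}"
  shows "dist1_set d W v \<le> dist1_set d W x + norm1_d d (\<lambda>i. v i - x i)"
proof -
  have "dist1_set d W v - norm1_d d (\<lambda>i. v i - x i) \<le> dist1_set d W x"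
    unfolding dist1_set_def[of d W x]
  proof (rule cINF_greatest[OF assms])
    fix y assume "y \<in> W"
    then show "dist1_set d W v - norm1_d d (\<lambda>i. v i - x i) \<le> norm1_d d (\<lambda>i. x i - y i)"
      using dist1_set_le[of y W d v] norm1_d_triangle[of d v y x] by linarith
  qed
  then show ?thesis by simp
qed

lemma dist1_subgradient_bound:
  assumes "W \<noteq> {}" "x \<in> vecs d" "i < d"
    and sub: "\<And>v. v \<in> vecs d \<Longrightarrow> dist1_set d W v \<ge> dist1_set d W x + inner_d d g (\<lambda>i. v i - x i)"
  shows "\<bar>g i\<bar> \<le> 1"
proof -
  have "g i * \<sigma> \<le> \<bar>\<sigma>\<bar>" for \<sigma> :: real
  proof -
    define v where "v = x(i := x i + \<sigma>)"
    have diff: "v j - x j = (if j = i then \<sigma> else 0)" for j by (simp add: v_def)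
    have "v \<in> vecs d" using assms(2,3) by (auto simp: v_def vecs_def)
    then have "inner_d d g (\<lambda>i. v i - x i) \<le> norm1_d d (\<lambda>i. v i - x i)"
      using sub[of v] dist1_set_lipschitz[OF assms(1), of d v x] by linarith
    moreover have "inner_d d g (\<lambda>i. v i - x i) = g i * \<sigma>"
      unfolding inner_d_def diff using assms(3) by (simp add: if_distrib cong: if_cong)
    moreover have "norm1_d d (\<lambda>i. v i - x i) = \<bar>\<sigma>\<bar>"
      unfolding norm1_d_def diff using assms(3) by (simp add: if_distrib cong: if_cong)
    ultimately show ?thesis by simp
  qed
  from this[of 1] this[of "- 1"] show ?thesis by auto
qed

lemma sq_regret_gradient_target:
  assumes "H > 0"
  shows "H / 2 * sq_regret (\<lambda>i. x i - g i / H) x w {..<d}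
    = - inner_d d g (\<lambda>i. w i - x i) - H / 2 * (norm2_d d (\<lambda>i. w i - x i))\<^sup>2"
proof -
  have "H / 2 * sq_regret (\<lambda>i. x i - g i / H) x w {..<d}
      = (\<Sum>i<d. - (g i * (w i - x i)) - H / 2 * (w i - x i)\<^sup>2)"
    unfolding sq_regret_def sum_distrib_left
    using assms by (intro sum.cong) (auto simp: field_simps power2_eq_square)
  also have "\<dots> = - inner_d d g (\<lambda>i. w i - x i) - H / 2 * (\<Sum>i<d. (w i - x i)\<^sup>2)"
    by (simp add: inner_d_def sum_subtractf sum_negf sum_distrib_left)
  finally show ?thesis by (simp add: norm2_d_def sum_nonneg)
qed

lemma strongly_convex_onD:
  assumes "strongly_convex_on_d d H D f Df" "x \<in> D" "y \<in> D"
  shows "f y \<ge> f x + inner_d d (Df x) (\<lambda>i. y i - x i) + H / 2 * (norm2_d d (\<lambda>i. y i - x i))\<^sup>2"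
  using assms unfolding strongly_convex_on_d_def by blast

lemma sum_total_variation_eq_path_length:
  "(\<Sum>i<d. total_variation (\<lambda>t. w t i) 1 n) = (\<Sum>t\<in>{2..n}. norm1_d d (\<lambda>i. w t i - w (t - 1) i))"
proof -
  have "(\<Sum>i<d. total_variation (\<lambda>t. w t i) 1 n) = (\<Sum>t\<in>{1..<n}. norm1_d d (\<lambda>i. w (Suc t) i - w t i))"
    unfolding total_variation_def norm1_d_def by (rule sum.swap)
  also have "\<dots> = (\<Sum>t\<in>{Suc 1..<Suc n}. norm1_d d (\<lambda>i. w t i - w (t - 1) i))"
    by (subst sum.atLeast_Suc_lessThan_Suc_shift) simp
  finally show ?thesis by (simp add: atLeastLessThanSuc_atLeastAtMost numeral_2_eq_2)
qed

definition target_radius :: "real \<Rightarrow> real \<Rightarrow> real \<Rightarrow> real" where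
  "target_radius H G B = 2 * B + 2 * G / H"

definition regret_constant :: "real \<Rightarrow> real \<Rightarrow> real \<Rightarrow> real" where
  "regret_constant H G B
    = H / 2 * (18 * (target_radius H G B)\<^sup>2 + B\<^sup>2) * (1 + 1 / root 3 (4 * B\<^sup>2))"

locale projected_flh_ogd =
  fixes H G B :: real and d n :: nat and W :: "(nat \<Rightarrow> real) set"
    and f :: "nat \<Rightarrow> (nat \<Rightarrow> real) \<Rightarrow> real" and Df :: "nat \<Rightarrow> (nat \<Rightarrow> real) \<Rightarrow> nat \<Rightarrow> real"
    and st :: "nat \<Rightarrow> real" and x xh sg w :: "nat \<Rightarrow> nat \<Rightarrow> real"
  assumes H_pos: "H > 0" and G_pos: "G > 0" and B_nonneg: "B \<ge> 0" and n_pos: "n \<ge> 1"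
    and W_subset_box: "W \<subseteq> box_d d B"
    and gradient_bound: "t \<in> {1..n} \<Longrightarrow> z \<in> box_d d B \<Longrightarrow> norminf_d d (Df t z) \<le> G"
    and strongly_convex: "t \<in> {1..n} \<Longrightarrow> strongly_convex_on_d d H (box_d d B) (f t) (Df t)"
    and start_bound: "i < d \<Longrightarrow> \<bar>st i\<bar> \<le> B"
    and iterate_vec: "t \<in> {1..n} \<Longrightarrow> x t \<in> vecs d"
    and iterate_eq: "t \<in> {1..n} \<Longrightarrow> i < d \<Longrightarrow>
      x t i = flh_pred (st i) B (1 / (2 * (2 * B + 2 * G / H)\<^sup>2))
        (\<lambda>\<tau>. x \<tau> i - (Df \<tau> (x \<tau>) i + G * sg \<tau> i) / H) t"
    and projection_mem: "t \<in> {1..n} \<Longrightarrow> xh t \<in> W"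
    and projection_min: "t \<in> {1..n} \<Longrightarrow> v \<in> W \<Longrightarrow>
      norm1_d d (\<lambda>i. x t i - xh t i) \<le> norm1_d d (\<lambda>i. x t i - v i)"
    and subgradient: "t \<in> {1..n} \<Longrightarrow> v \<in> vecs d \<Longrightarrow>
      dist1_set d W v \<ge> dist1_set d W (x t) + inner_d d (sg t) (\<lambda>i. v i - x t i)"
    and comparator_mem: "t \<in> {1..n} \<Longrightarrow> w t \<in> W"
begin

definition target :: "nat \<Rightarrow> nat \<Rightarrow> real" where
  "target i t = x t i - (Df t (x t) i + G * sg t i) / H"

abbreviation radius :: real where
  "radius \<equiv> target_radius H G B"

lemma radius_pos: "radius > 0"
  using H_pos G_pos B_nonneg by (simp add: target_radius_def add_nonneg_pos)

lemma iterate_eq_target: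
  "t \<in> {1..n} \<Longrightarrow> i < d \<Longrightarrow> x t i = flh_pred (st i) B (1 / (2 * radius\<^sup>2)) (target i) t"
  unfolding target_def[abs_def] target_radius_def by (rule iterate_eq)

lemma box_bound: "z \<in> box_d d B \<Longrightarrow> i < d \<Longrightarrow> \<bar>z i\<bar> \<le> B"
  using B_nonneg by (simp add: box_d_def norminf_d_le_iff)

lemma iterate_in_box:
  assumes "t \<in> {1..n}"
  shows "x t \<in> box_d d B"
proof -
  have "\<bar>x t i\<bar> \<le> B" if "i < d" for i
  proof -
    interpret flh_ogd "st i" B "1 / (2 * radius\<^sup>2)" "target i"
      using start_bound[OF that] by unfold_locales
    show ?thesis using abs_forecast_le[of t] iterate_eq_target[OF assms that] assms by simp
  qed
  then show ?thesis
    using iterate_vec[OF assms] B_nonneg by (simp add: box_d_def norminf_d_le_iff)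
qed

lemma target_bound:
  assumes round: "t \<in> {1..n}" and coord: "i < d"
  shows "B + \<bar>target i t\<bar> \<le> radius"
proof -
  have "\<bar>Df t (x t) i\<bar> \<le> G"
    using abs_le_norminf_d[OF coord] gradient_bound[OF round iterate_in_box[OF round]]
    by (rule order.trans)
  moreover have "\<bar>sg t i\<bar> \<le> 1"
    using projection_mem[OF round] iterate_vec[OF round] coord subgradient[OF round]
    by (intro dist1_subgradient_bound[of W "x t" d i "sg t"]) auto
  then have "\<bar>G * sg t i\<bar> \<le> G" using G_pos by (simp add: abs_mult)
  ultimately have "\<bar>Df t (x t) i + G * sg t i\<bar> \<le> 2 * G" by linarith
  then have "\<bar>(Df t (x t) i + G * sg t i) / H\<bar> \<le> 2 * G / H"
    using H_pos by (simp add: divide_right_mono)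
  then show ?thesis
    using box_bound[OF iterate_in_box[OF round] coord]
    unfolding target_def target_radius_def by linarith
qed

lemma projected_loss_le_surrogate:
  assumes round: "t \<in> {1..n}"
  shows "f t (xh t) \<le> f t (x t) + G * dist1_set d W (x t)"
proof -
  let ?z = "\<lambda>i. x t i - xh t i"
  have xh_in_box: "xh t \<in> box_d d B" using projection_mem[OF round] W_subset_box by blast
  have "0 \<le> H / 2 * (norm2_d d ?z)\<^sup>2" using H_pos by simp
  then have "f t (xh t) \<le> f t (x t) + \<bar>inner_d d (Df t (xh t)) ?z\<bar>"
    using strongly_convex_onD[OF strongly_convex[OF round] xh_in_box iterate_in_box[OF round]]
    by linarith
  also have "\<bar>inner_d d (Df t (xh t)) ?z\<bar> \<le> G * norm1_d d ?z"
    using abs_inner_d_le mult_right_mono[OF gradient_bound[OF round xh_in_box] norm1_d_nonneg]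
    by (rule order.trans)
  also have "norm1_d d ?z \<le> dist1_set d W (x t)"
    unfolding dist1_set_def using projection_mem[OF round] projection_min[OF round]
    by (intro cINF_greatest) auto
  finally show ?thesis using G_pos by simp
qed

lemma round_regret_le:
  assumes round: "t \<in> {1..n}"
  shows "f t (xh t) - f t (w t) \<le> H / 2 * sq_regret (\<lambda>i. target i t) (x t) (w t) {..<d}"
proof -
  let ?z = "\<lambda>i. w t i - x t i"
  have w_in_box: "w t \<in> box_d d B" using comparator_mem[OF round] W_subset_box by blast
  have "dist1_set d W (w t) \<le> 0"
    using dist1_set_le[OF comparator_mem[OF round], of d "w t"] by (simp add: norm1_d_def)
  then have "dist1_set d W (x t) \<le> - inner_d d (sg t) ?z"
    using subgradient[OF round, of "w t"] w_in_box by (simp add: box_d_def)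
  then have "G * dist1_set d W (x t) \<le> G * - inner_d d (sg t) ?z"
    using G_pos by (intro mult_left_mono) auto
  moreover have "inner_d d (\<lambda>i. Df t (x t) i + G * sg t i) ?z
      = inner_d d (Df t (x t)) ?z + G * inner_d d (sg t) ?z"
    by (simp add: inner_d_def algebra_simps sum.distrib sum_subtractf sum_distrib_left)
  ultimately have "f t (xh t) - f t (w t)
      \<le> - inner_d d (\<lambda>i. Df t (x t) i + G * sg t i) ?z - H / 2 * (norm2_d d ?z)\<^sup>2"
    using projected_loss_le_surrogate[OF round]
      strongly_convex_onD[OF strongly_convex[OF round] iterate_in_box[OF round] w_in_box] by simp
  also have "\<dots> = H / 2 * sq_regret (\<lambda>i. target i t) (x t) (w t) {..<d}"
    unfolding target_def sq_regret_gradient_target[OF H_pos] ..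
  finally show ?thesis .
qed

lemma coordinate_regret_le:
  assumes coord: "i < d"
  shows "sq_regret (target i) (\<lambda>t. x t i) (\<lambda>t. w t i) {1..n}
    \<le> (18 * radius\<^sup>2 + B\<^sup>2) * (1 + ln (real n))
    * (1 + root 3 (real n * (total_variation (\<lambda>t. w t i) 1 n)\<^sup>2 / (4 * B\<^sup>2)))"
proof -
  interpret flh_ogd "st i" B "1 / (2 * radius\<^sup>2)" "target i"
    using start_bound[OF coord] by unfold_locales
  have "sq_regret (target i) (\<lambda>t. x t i) (\<lambda>t. w t i) {1..n}
      = sq_regret (target i) forecast (\<lambda>t. w t i) {1..n}"
    unfolding sq_regret_def using iterate_eq_target[OF _ coord] by (intro sum.cong) auto
  also have "\<dots> \<le> (18 * radius\<^sup>2 + B\<^sup>2) * (1 + ln (real n))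
      * (1 + root 3 (real n * (total_variation (\<lambda>t. w t i) 1 n)\<^sup>2 / (4 * B\<^sup>2)))"
    using target_bound[OF _ coord] box_bound[OF _ coord] comparator_mem W_subset_box
    by (intro dynamic_regret radius_pos n_pos refl) blast+
  finally show ?thesis .
qed

lemma regret_le_sum_coordinate_regret:
  "(\<Sum>t\<in>{1..n}. f t (xh t) - f t (w t))
    \<le> H / 2 * (\<Sum>i<d. sq_regret (target i) (\<lambda>t. x t i) (\<lambda>t. w t i) {1..n})"
proof -
  have "(\<Sum>t\<in>{1..n}. f t (xh t) - f t (w t))
      \<le> (\<Sum>t\<in>{1..n}. H / 2 * sq_regret (\<lambda>i. target i t) (x t) (w t) {..<d})"
    by (intro sum_mono round_regret_le)
  also have "\<dots> = H / 2 * (\<Sum>i<d. sq_regret (target i) (\<lambda>t. x t i) (\<lambda>t. w t i) {1..n})"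
    unfolding sq_regret_def sum_distrib_left[symmetric] by (subst sum.swap) (rule refl)
  finally show ?thesis .
qed

lemma sum_root3_total_variation_le:
  assumes "(\<Sum>t\<in>{2..n}. norm1_d d (\<lambda>i. w t i - w (t - 1) i)) \<le> C"
  shows "(\<Sum>i<d. root 3 ((total_variation (\<lambda>t. w t i) 1 n)\<^sup>2)) \<le> root 3 (real d) * root 3 (C\<^sup>2)"
proof -
  have "(\<Sum>i<d. root 3 ((total_variation (\<lambda>t. w t i) 1 n)\<^sup>2))
      \<le> root 3 (real d) * root 3 ((\<Sum>i<d. total_variation (\<lambda>t. w t i) 1 n)\<^sup>2)"
    using sum_root3_square_le[of "{..<d}" "\<lambda>i. total_variation (\<lambda>t. w t i) 1 n"]
      total_variation_nonneg by simp
  also have "\<dots> \<le> root 3 (real d) * root 3 (C\<^sup>2)"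
    using assms unfolding sum_total_variation_eq_path_length
    by (intro mult_left_mono) (auto intro!: power_mono sum_nonneg norm1_d_nonneg)
  finally show ?thesis .
qed

lemma regret_le:
  assumes "(\<Sum>t\<in>{2..n}. norm1_d d (\<lambda>i. w t i - w (t - 1) i)) \<le> C"
  shows "(\<Sum>t\<in>{1..n}. f t (xh t) - f t (w t)) \<le> regret_constant H G B * (1 + ln (real n))
    * max (root 3 (real d) * root 3 (real n) * root 3 (C\<^sup>2)) (real d)"
proof -
  define \<kappa> where "\<kappa> = root 3 (4 * B\<^sup>2)"
  define \<Lambda> where "\<Lambda> = 1 + ln (real n)"
  define M where "M = H / 2 * (18 * radius\<^sup>2 + B\<^sup>2)"
  define R where "R = root 3 (real d) * root 3 (real n) * root 3 (C\<^sup>2)"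
  let ?V = "\<lambda>i. total_variation (\<lambda>t. w t i) 1 n"
  have nonneg: "\<kappa> \<ge> 0" "M * \<Lambda> \<ge> 0" using H_pos n_pos by (auto simp: \<kappa>_def \<Lambda>_def M_def)
  have "(\<Sum>t\<in>{1..n}. f t (xh t) - f t (w t))
      \<le> H / 2 * (\<Sum>i<d. (18 * radius\<^sup>2 + B\<^sup>2) * \<Lambda> * (1 + root 3 (real n) * root 3 ((?V i)\<^sup>2) / \<kappa>))"
    using regret_le_sum_coordinate_regret coordinate_regret_le H_pos unfolding \<Lambda>_def \<kappa>_def
    by (elim order.trans, intro mult_left_mono sum_mono) (auto simp: real_root_mult real_root_divide)
  also have "\<dots> = M * \<Lambda> * (real d + root 3 (real n) * (\<Sum>i<d. root 3 ((?V i)\<^sup>2)) / \<kappa>)"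
    by (simp add: M_def sum.distrib mult.assoc flip: sum_distrib_left sum_divide_distrib)
  also have "\<dots> \<le> M * \<Lambda> * (real d + root 3 (real n) * (root 3 (real d) * root 3 (C\<^sup>2)) / \<kappa>)"
    using nonneg sum_root3_total_variation_le[OF assms]
    by (intro mult_left_mono add_left_mono divide_right_mono) auto
  also have "\<dots> = M * \<Lambda> * (real d + R / \<kappa>)" by (simp add: R_def mult_ac)
  also have "\<dots> \<le> M * \<Lambda> * (max R (real d) + max R (real d) / \<kappa>)"
    using nonneg by (intro mult_left_mono add_mono divide_right_mono) auto
  also have "\<dots> = M * (1 + 1 / \<kappa>) * \<Lambda> * max R (real d)"
    by (simp add: algebra_simps)
  finally show ?thesis unfolding regret_constant_def M_def \<kappa>_def \<Lambda>_def R_def .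
qed

end

theorem theorem2:
  fixes H G B :: real
  assumes "H > 0" and "G > 0" and "B \<ge> 0"
  shows "\<exists>(K::real) (p::nat). \<forall>(d::nat) (n::nat) (Cn::real)
           (W :: (nat \<Rightarrow> real) set)
           (f :: nat \<Rightarrow> (nat \<Rightarrow> real) \<Rightarrow> real)
           (Df :: nat \<Rightarrow> (nat \<Rightarrow> real) \<Rightarrow> (nat \<Rightarrow> real))
           (st :: nat \<Rightarrow> real)
           (x :: nat \<Rightarrow> nat \<Rightarrow> real) (xh :: nat \<Rightarrow> nat \<Rightarrow> real)
           (sg :: nat \<Rightarrow> nat \<Rightarrow> real) (w :: nat \<Rightarrow> nat \<Rightarrow> real).
         d \<ge> 1 \<and> n \<ge> 1 \<and> Cn \<ge> 0
         \<comment> \<open>the decision set W and B = sup of the sup-norm over W\<close>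
         \<and> W \<subseteq> vecs d \<and> W \<noteq> {} \<and> compact W \<and> convex_d W
         \<and> B = (SUP v\<in>W. norminf_d d v)
         \<comment> \<open>losses: differentiable, H-strongly convex on D, gradient sup-norm bounded by G\<close>
         \<and> (\<forall>t\<in>{1..n}. (\<forall>z\<in>box_d d B. has_grad_within d (f t) (Df t z) z (box_d d B)
                                        \<and> norminf_d d (Df t z) \<le> G)
                        \<and> strongly_convex_on_d d H (box_d d B) (f t) (Df t))
         \<comment> \<open>fixed start points of the d univariate FLH-OGD instances\<close>
         \<and> (\<forall>i<d. \<bar>st i\<bar> \<le> B)
         \<comment> \<open>the scheme, rounds 1..n\<close>
         \<and> (\<forall>t\<in>{1..n}.
              x t \<in> vecs d
            \<and> (\<forall>i<d. x t i = flh_pred (st i) B (1 / (2 * (2 * B + 2 * G / H)\<^sup>2))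
                                 (\<lambda>\<tau>. x \<tau> i - (Df \<tau> (x \<tau>) i + G * sg \<tau> i) / H) t)
            \<and> xh t \<in> W \<and> (\<forall>v\<in>W. norm1_d d (\<lambda>i. x t i - xh t i) \<le> norm1_d d (\<lambda>i. x t i - v i))
            \<and> sg t \<in> vecs d
            \<and> (\<forall>v\<in>vecs d. dist1_set d W v \<ge> dist1_set d W (x t) + inner_d d (sg t) (\<lambda>i. v i - x t i)))
         \<comment> \<open>comparator sequence with path length at most Cn\<close>
         \<and> (\<forall>t\<in>{1..n}. w t \<in> W)
         \<and> (\<Sum>t\<in>{2..n}. norm1_d d (\<lambda>i. w t i - w (t - 1) i)) \<le> Cn
       \<longrightarrow> (\<Sum>t\<in>{1..n}. f t (xh t) - f t (w t))
           \<le> K * (1 + ln (real n)) ^ p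
               * max (root 3 (real d) * root 3 (real n) * root 3 (Cn\<^sup>2)) (real d)"
proof (intro exI[of _ "regret_constant H G B"] exI[of _ 1] allI impI, elim conjE, goal_cases)
  case (1 d n Cn W f Df st x xh sg w)
  then have "W \<subseteq> box_d d B" by (intro compact_subset_box)
  with 1 assms interpret projected_flh_ogd H G B d n W f Df st x xh sg w
    by unfold_locales auto
  show ?case using 1 regret_le[of Cn] by simp
qed

end
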